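(* Let $m\ge 2$ and $n\ge 1$ be integers. For $a>0$ let $p(\mathbf{x}\mid a)$ be the Dirichlet-multinomial probability mass function $$p(\mathbf{x}\mid a)=\frac{n!}{x_1!\cdots x_m!}\,\frac{\Gamma(ma)}{\Gamma(a)^m}\,\frac{\prod_{i=1}^m\Gamma(x_i+a)}{\Gamma(n+ma)},\qquad \mathbf{x}=(x_1,\dots,x_m)\in\mathbb{Z}_{\ge0}^m,\ \sum_{i=1}^m x_i=n.$$ Then the reference (Jeffreys) prior $\pi^R(a\mid m,n)$ for $a\in(0,\infty)$ in this model is $$\pi^R(a\mid m,n)\ \propto\ \left[\sum_{j=0}^{n-1}\left(\frac{Q(j\mid a,m,n)}{(a+j)^2}-\frac{m}{(ma+j)^2}\right)\right]^{1/2},$$ where $\propto$ means equality up to a positive multiplicative constant not depending on $a$, and $$Q(j\mid a,m,n)=\sum_{l=j+1}^n p(l\mid a,m,n),\qquad j=0,\dots,n-1,$$ with $$p(l\mid a,m,n)=\binom{n}{l}\frac{\Gamma(l+a)\,\Gamma(n-l+(m-1)a)\,\Gamma(ma)}{\Gamma(a)\,\Gamma((m-1)a)\,\Gamma(n+ma)},\qquad l=0,\dots,n,$$ the marginal probability mass function of any single coordinate $x_i$.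
   Context: The model $p(\mathbf{x}\mid a)$ is the marginal distribution of a multinomial vector $\mathbf{x}$ with $n$ trials and cell probabilities $(\theta_1,\dots,\theta_m)$ when $(\theta_1,\dots,\theta_m)$ has the symmetric Dirichlet$(a,\dots,a)$ distribution. For this one-parameter model, the reference prior is the Jeffreys prior, i.e. the function of $a$ proportional to the square root of the Fisher information $$I(a)=\mathrm{E}_{\mathbf{x}\mid a}\left[-\frac{d^2}{da^2}\log p(\mathbf{x}\mid a)\right].$$ *)

theory Defs
  imports "HOL-Probability.Probability"
begin

definition fisher_information :: "(real \<Rightarrow> 'a pmf) \<Rightarrow> real \<Rightarrow> real" where
  "fisher_information P a =
     measure_pmf.expectation (P a) (\<lambda>x. - deriv (deriv (\<lambda>t. ln (pmf (P t) x))) a)"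

text \<open>
  A Jeffreys prior is possibly improper and determined only up to a positive constant factor, so
  this is a predicate on functions \<open>\<pi>\<close>, of which only the values on the parameter space \<open>\<Theta>\<close> matter.
  In a regular one-parameter model this is also what is called the reference prior.
\<close>

definition is_jeffreys_prior :: "(real \<Rightarrow> 'a pmf) \<Rightarrow> real set \<Rightarrow> (real \<Rightarrow> real) \<Rightarrow> bool" where
  "is_jeffreys_prior P \<Theta> \<pi> \<longleftrightarrow> (\<exists>c>0. \<forall>a\<in>\<Theta>. \<pi> a = c * sqrt (fisher_information P a))"

text \<open>
  Vectors of cell counts are functions on \<open>{1..m}\<close>, with the value \<open>undefined\<close> elsewhere.
\<close>

definition count_vectors :: "nat \<Rightarrow> nat \<Rightarrow> (nat \<Rightarrow> nat) set" where
  "count_vectors m n = {x \<in> {1..m} \<rightarrow>\<^sub>E UNIV. (\<Sum>i=1..m. x i) = n}"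

definition dirmult_mass :: "nat \<Rightarrow> nat \<Rightarrow> real \<Rightarrow> (nat \<Rightarrow> nat) \<Rightarrow> real" where
  "dirmult_mass m n a x =
     fact n / (\<Prod>i=1..m. fact (x i)) *
     (Gamma (real m * a) / Gamma a ^ m) *
     ((\<Prod>i=1..m. Gamma (real (x i) + a)) / Gamma (real n + real m * a))"

text \<open>
  The Dirichlet-multinomial distribution; see \<open>pmf_dirichlet_multinomial\<close> below for the
  justification of \<open>embed_pmf\<close>. Only \<open>m \<ge> 1\<close> and \<open>a > 0\<close> are meaningful.
\<close>

definition dirichlet_multinomial :: "nat \<Rightarrow> nat \<Rightarrow> real \<Rightarrow> (nat \<Rightarrow> nat) pmf" where
  "dirichlet_multinomial m n a =
     embed_pmf (\<lambda>x. if x \<in> count_vectors m n then dirmult_mass m n a x else 0)"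

definition marginal_mass :: "nat \<Rightarrow> nat \<Rightarrow> real \<Rightarrow> nat \<Rightarrow> real" where
  "marginal_mass m n a l =
     real (n choose l) *
     (Gamma (real l + a) * Gamma (real (n - l) + (real m - 1) * a) * Gamma (real m * a)) /
     (Gamma a * Gamma ((real m - 1) * a) * Gamma (real n + real m * a))"

definition Q :: "nat \<Rightarrow> nat \<Rightarrow> real \<Rightarrow> nat \<Rightarrow> real" where
  "Q m n a j = (\<Sum>l=j+1..n. marginal_mass m n a l)"

lemma finite_fixed_sum:
  assumes "finite I"
  shows "finite {x \<in> I \<rightarrow>\<^sub>E (UNIV :: nat set). sum x I = n}"
proof (rule finite_subset)
  show "{x \<in> I \<rightarrow>\<^sub>E (UNIV :: nat set). sum x I = n} \<subseteq> I \<rightarrow>\<^sub>E {..n}"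
  proof
    fix x assume x: "x \<in> {x \<in> I \<rightarrow>\<^sub>E (UNIV :: nat set). sum x I = n}"
    then have "x i \<le> n" if "i \<in> I" for i
      using member_le_sum[of i I x] that assms by auto
    then show "x \<in> I \<rightarrow>\<^sub>E {..n}" using x by (auto simp: PiE_iff)
  qed
qed (use assms in \<open>auto intro: finite_PiE\<close>)

lemma finite_count_vectors: "finite (count_vectors m n)"
  unfolding count_vectors_def by (rule finite_fixed_sum) simp

lemma sum_prod_pochhammer:
  fixes a :: real
  assumes "finite I"
  shows "(\<Sum>x | x \<in> I \<rightarrow>\<^sub>E (UNIV :: nat set) \<and> sum x I = n. \<Prod>i\<in>I. pochhammer a (x i) / fact (x i))
         = pochhammer (real (card I) * a) n / fact n"
  using assms
proof (induction I arbitrary: n rule: finite_induct)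
  case empty
  have "{x :: 'a \<Rightarrow> nat. x = (\<lambda>_. undefined) \<and> n = 0} = (if n = 0 then {\<lambda>_. undefined} else {})"
    by auto
  then show ?case by (cases n) (auto simp: pochhammer_Suc_prod)
next
  case (insert j I)
  let ?S = "\<lambda>I n. {x \<in> I \<rightarrow>\<^sub>E (UNIV :: nat set). sum x I = n}"
  let ?f = "\<lambda>k. pochhammer a k / fact k"
  have "(\<Sum>x\<in>?S (insert j I) n. \<Prod>i\<in>insert j I. ?f (x i))
        = (\<Sum>(k, y)\<in>Sigma {..n} (\<lambda>k. ?S I (n - k)). ?f k * (\<Prod>i\<in>I. ?f (y i)))"
  proof (rule sum.reindex_bij_witness
      [of _ "\<lambda>(k, y). y(j := k)" "\<lambda>x. (x j, x(j := undefined))"])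
    fix x assume x: "x \<in> ?S (insert j I) n"
    have e: "sum (x(j := undefined)) I = sum x I"
      using insert.hyps by (intro sum.cong) auto
    have p: "(\<Prod>i\<in>I. ?f ((x(j := undefined)) i)) = (\<Prod>i\<in>I. ?f (x i))"
      using insert.hyps by (intro prod.cong) auto
    show "(case (x j, x(j := undefined)) of (k, y) \<Rightarrow> y(j := k)) = x" by simp
    show "(x j, x(j := undefined)) \<in> Sigma {..n} (\<lambda>k. ?S I (n - k))"
      using x e insert.hyps by (auto simp: PiE_iff extensional_def)
    show "(case (x j, x(j := undefined)) of (k, y) \<Rightarrow> ?f k * (\<Prod>i\<in>I. ?f (y i)))
          = (\<Prod>i\<in>insert j I. ?f (x i))"
      using p insert.hyps by simp
  next
    fix z assume z: "z \<in> Sigma {..n} (\<lambda>k. ?S I (n - k))"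
    obtain k y where [simp]: "z = (k, y)" by (cases z)
    have e: "sum (y(j := k)) I = sum y I"
      using insert.hyps by (intro sum.cong) auto
    have u: "y j = undefined" using z insert.hyps by (auto simp: PiE_iff extensional_def)
    show "(case z of (k, y) \<Rightarrow> y(j := k)) \<in> ?S (insert j I) n"
      using z e insert.hyps by (auto simp: PiE_iff extensional_def)
    show "((case z of (k, y) \<Rightarrow> y(j := k)) j, (case z of (k, y) \<Rightarrow> y(j := k))(j := undefined)) = z"
      using u by (auto simp: fun_eq_iff)
  qed
  also have "\<dots> = (\<Sum>k\<le>n. ?f k * (\<Sum>y\<in>?S I (n - k). \<Prod>i\<in>I. ?f (y i)))"
    using insert.hyps by (subst sum.Sigma[symmetric]) (auto simp: sum_distrib_left finite_fixed_sum)
  also have "\<dots> = (\<Sum>k\<le>n. ?f k * (pochhammer (real (card I) * a) (n - k) / fact (n - k)))"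
    using insert.IH by simp
  also have "\<dots> = (\<Sum>k\<le>n. real (n choose k) * pochhammer a k
                      * pochhammer (real (card I) * a) (n - k)) / fact n"
    unfolding sum_divide_distrib by (intro sum.cong) (auto simp: binomial_fact field_simps)
  also have "\<dots> = pochhammer (a + real (card I) * a) n / fact n"
    by (simp add: pochhammer_binomial_sum)
  finally show ?case using insert.hyps by (simp add: algebra_simps)
qed

lemma dirmult_mass_eq_pochhammer:
  assumes "m \<ge> 1" "a > 0"
  shows "dirmult_mass m n a x =
         fact n / pochhammer (real m * a) n * (\<Prod>i=1..m. pochhammer a (x i) / fact (x i))"
proof -
  have poch: "Gamma (real k + b) = pochhammer b k * Gamma b" if "b > 0" for k and b :: real
  proof -
    have "Gamma b \<noteq> 0" using Gamma_real_pos[OF that] by linarith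
    moreover have "b \<notin> \<int>\<^sub>\<le>\<^sub>0" using that by (auto dest: nonpos_Ints_nonpos)
    ultimately show ?thesis by (simp add: pochhammer_Gamma add.commute)
  qed
  have pos: "Gamma a > 0" "Gamma (real m * a) > 0" "pochhammer (real m * a) n > 0"
    using assms by (auto intro!: Gamma_real_pos pochhammer_pos)
  have "(\<Prod>i=1..m. Gamma (real (x i) + a)) = (\<Prod>i=1..m. pochhammer a (x i)) * Gamma a ^ m"
    using assms by (simp add: poch prod.distrib)
  moreover have "Gamma (real n + real m * a) = pochhammer (real m * a) n * Gamma (real m * a)"
    using assms by (intro poch) auto
  ultimately show ?thesis
    using pos by (simp add: dirmult_mass_def prod_dividef)
qed

lemma dirmult_mass_nonneg:
  assumes "m \<ge> 1" "a > 0"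
  shows "dirmult_mass m n a x \<ge> 0"
  unfolding dirmult_mass_eq_pochhammer[OF assms]
  using assms by (intro mult_nonneg_nonneg divide_nonneg_nonneg prod_nonneg)
    (auto intro!: less_imp_le[OF pochhammer_pos])

lemma sum_dirmult_mass:
  assumes "m \<ge> 1" "a > 0"
  shows "(\<Sum>x\<in>count_vectors m n. dirmult_mass m n a x) = 1"
proof -
  have "pochhammer (real m * a) n > 0" using assms by (intro pochhammer_pos) auto
  moreover have "(\<Sum>x\<in>count_vectors m n. dirmult_mass m n a x)
      = fact n / pochhammer (real m * a) n *
        (\<Sum>x\<in>count_vectors m n. \<Prod>i=1..m. pochhammer a (x i) / fact (x i))"
    unfolding dirmult_mass_eq_pochhammer[OF assms] sum_distrib_left ..
  moreover have "(\<Sum>x\<in>count_vectors m n. \<Prod>i=1..m. pochhammer a (x i) / fact (x i))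
      = pochhammer (real m * a) n / fact n"
    unfolding count_vectors_def
    using sum_prod_pochhammer[where I = "{1..m}" and n = n and a = a] by simp
  ultimately show ?thesis by simp
qed

lemma pmf_dirichlet_multinomial:
  assumes "m \<ge> 1" "a > 0"
  shows "pmf (dirichlet_multinomial m n a) x =
         (if x \<in> count_vectors m n then dirmult_mass m n a x else 0)"
  unfolding dirichlet_multinomial_def
proof (rule pmf_embed_pmf)
  let ?f = "\<lambda>x. if x \<in> count_vectors m n then dirmult_mass m n a x else 0"
  show "0 \<le> ?f x" for x using dirmult_mass_nonneg[OF assms] by auto
  have "(\<integral>\<^sup>+ x. ennreal (?f x) \<partial>count_space UNIV) = (\<Sum>x\<in>count_vectors m n. ennreal (?f x))"
    by (rule nn_integral_count_space') (auto simp: finite_count_vectors)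
  also have "\<dots> = ennreal (\<Sum>x\<in>count_vectors m n. dirmult_mass m n a x)"
    using dirmult_mass_nonneg[OF assms] by (subst sum_ennreal[symmetric]) auto
  finally show "(\<integral>\<^sup>+ x. ennreal (?f x) \<partial>count_space UNIV) = 1"
    using sum_dirmult_mass[OF assms] by simp
qed

end

theory Submission
  imports Defs
begin

text \<open>
  Writing Gamma quotients as products, \<open>log p(x | a)\<close> is, up to a constant, the sum over
  \<open>i\<close> and \<open>j < x\<^sub>i\<close> of \<open>log (a + j)\<close> minus the sum over \<open>j < n\<close> of \<open>log (m a + j)\<close>. Taking the
  expectation of the second derivative, the term \<open>1 / (a + j)\<^sup>2\<close> is weighted by
  \<open>P(x\<^sub>i > j) = Q(j)\<close> for each of the \<open>m\<close> coordinates, so the Fisher information is \<open>m\<close> times the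
  sum under the root. It is nonnegative because it equals the second moment of the score, as is
  seen by differentiating the identity \<open>\<Sum>\<^sub>x p(x | a) = 1\<close> twice.
\<close>

section \<open>Rising factorials and the law of a single coordinate\<close>

lemma Gamma_real_add_of_nat:
  fixes b :: real
  assumes "b > 0"
  shows "Gamma (real k + b) = pochhammer b k * Gamma b"
proof -
  have "Gamma b \<noteq> 0" using Gamma_real_pos[OF assms] by linarith
  moreover have "b \<notin> \<int>\<^sub>\<le>\<^sub>0" using assms by (auto dest: nonpos_Ints_nonpos)
  ultimately show ?thesis by (simp add: pochhammer_Gamma add.commute)
qed

text \<open>Brings the marginal to the same normal form as
  \<open>dirmult_mass_eq_pochhammer\<close>, so that the two can be compared factor by factor. With
  m \<ge> 2 the parameter (m - 1) a is positive, so its Gamma value can be cancelled.\<close>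

lemma marginal_mass_eq_pochhammer:
  assumes "m \<ge> 2" "a > 0" "l \<le> n"
  shows "marginal_mass m n a l = fact n / pochhammer (real m * a) n *
    (pochhammer a l / fact l * (pochhammer (real (m - 1) * a) (n - l) / fact (n - l)))"
proof -
  have m1: "real m - 1 = real (m - 1)" using assms by simp
  have pos: "Gamma a > 0" "Gamma (real m * a) > 0" "Gamma (real (m - 1) * a) > 0"
    "pochhammer (real m * a) n > 0"
    using assms by (auto intro!: Gamma_real_pos pochhammer_pos)
  have G: "Gamma (real l + a) = pochhammer a l * Gamma a"
    "Gamma (real (n - l) + real (m - 1) * a)
       = pochhammer (real (m - 1) * a) (n - l) * Gamma (real (m - 1) * a)"
    "Gamma (real n + real m * a) = pochhammer (real m * a) n * Gamma (real m * a)"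
    by (rule Gamma_real_add_of_nat; use assms in simp)+
  have b: "real (n choose l) = fact n / (fact l * fact (n - l))"
    using assms by (simp add: binomial_fact)
  show ?thesis
    unfolding marginal_mass_def m1 G b using pos by (simp add: field_simps)
qed

text \<open>Fixing coordinate i at l leaves an arbitrary vector of total n - l on the other m - 1
  coordinates. The Vandermonde-type identity \<open>sum_prod_pochhammer\<close> evaluates the sum
  over these.\<close>

lemma sum_dirmult_mass_coordinate:
  assumes "m \<ge> 2" "a > 0" "i \<in> {1..m}" "l \<le> n"
  shows "(\<Sum>x | x \<in> count_vectors m n \<and> x i = l. dirmult_mass m n a x) = marginal_mass m n a l"
proof -
  let ?J = "{1..m} - {i}"
  let ?f = "\<lambda>k. pochhammer a k / fact k"
  let ?T = "{y. y \<in> ?J \<rightarrow>\<^sub>E (UNIV :: nat set) \<and> sum y ?J = n - l}"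
  have split: "sum x {1..m} = x i + sum x ?J" for x :: "nat \<Rightarrow> nat"
    using assms by (intro sum.remove) auto
  have psplit: "(\<Prod>k=1..m. ?f (x k)) = ?f (x i) * (\<Prod>k\<in>?J. ?f (x k))" for x
    using assms by (intro prod.remove) auto
  have upd: "sum (x(i := v)) ?J = sum x ?J" for x :: "nat \<Rightarrow> nat" and v
    by (intro sum.cong) auto
  have "(\<Sum>x | x \<in> count_vectors m n \<and> x i = l. \<Prod>k=1..m. ?f (x k))
      = (\<Sum>y\<in>?T. ?f l * (\<Prod>k\<in>?J. ?f (y k)))"
  \<comment> \<open>Deleting a coordinate means resetting it to \<open>undefined\<close>, since
    elements of \<open>?T\<close> are extensional on the smaller index set.\<close>
  proof (rule sum.reindex_bij_witness [of _ "\<lambda>y. y(i := l)" "\<lambda>x. x(i := undefined)"])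
    fix x assume x: "x \<in> {x. x \<in> count_vectors m n \<and> x i = l}"
    show "(x(i := undefined))(i := l) = x" using x by auto
    show "x(i := undefined) \<in> ?T"
      using x split[of x] upd by (auto simp: count_vectors_def PiE_iff extensional_def)
    have "(\<Prod>k\<in>?J. ?f ((x(i := undefined)) k)) = (\<Prod>k\<in>?J. ?f (x k))"
      by (intro prod.cong) auto
    then show "?f l * (\<Prod>k\<in>?J. ?f ((x(i := undefined)) k)) = (\<Prod>k=1..m. ?f (x k))"
      using x psplit[of x] by simp
  next
    fix y assume y: "y \<in> ?T"
    have "y i = undefined" using y by (auto simp: PiE_iff extensional_def)
    then show "(y(i := l))(i := undefined) = y" by (auto simp: fun_eq_iff)
    show "y(i := l) \<in> {x. x \<in> count_vectors m n \<and> x i = l}"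
      using y assms split[of "y(i := l)"] upd[of y l]
      by (auto simp: count_vectors_def PiE_iff extensional_def)
  qed
  also have "\<dots> = ?f l * (pochhammer (real (m - 1) * a) (n - l) / fact (n - l))"
    using sum_prod_pochhammer[where I = ?J and n = "n - l" and a = a] assms
    unfolding sum_distrib_left[symmetric] by simp
  finally have sum_prod: "(\<Sum>x | x \<in> count_vectors m n \<and> x i = l. \<Prod>k=1..m. ?f (x k))
      = ?f l * (pochhammer (real (m - 1) * a) (n - l) / fact (n - l))" .
  have m: "m \<ge> 1" using assms by simp
  show ?thesis
    unfolding marginal_mass_eq_pochhammer[OF assms(1,2,4)] dirmult_mass_eq_pochhammer[OF m assms(2)]
      sum_distrib_left[symmetric] sum_prod ..
qed

lemma count_vectors_le: "x \<in> count_vectors m n \<Longrightarrow> i \<in> {1..m} \<Longrightarrow> x i \<le> n"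
  using member_le_sum[of i "{1..m}" x] by (auto simp: count_vectors_def)

text \<open>Grouping the vectors by the value of coordinate i turns the mean of a function of that
  coordinate into a mean under the marginal.\<close>

lemma sum_dirmult_mass_times_coordinate:
  assumes "m \<ge> 2" "a > 0" "i \<in> {1..m}"
  shows "(\<Sum>x\<in>count_vectors m n. dirmult_mass m n a x * g (x i))
       = (\<Sum>l\<le>n. marginal_mass m n a l * g l)"
proof -
  have "(\<Sum>x\<in>count_vectors m n. dirmult_mass m n a x * g (x i))
      = (\<Sum>l\<le>n. \<Sum>x | x \<in> count_vectors m n \<and> x i = l. dirmult_mass m n a x * g (x i))"
    using assms(3) by (intro sum.group[symmetric])
      (auto simp: finite_count_vectors dest: count_vectors_le)
  also have "\<dots> = (\<Sum>l\<le>n. (\<Sum>x | x \<in> count_vectors m n \<and> x i = l. dirmult_mass m n a x) * g l)"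
    by (auto simp: sum_distrib_right intro!: sum.cong)
  finally show ?thesis using assms by (simp add: sum_dirmult_mass_coordinate)
qed

lemma pmf_map_coordinate:
  assumes "m \<ge> 2" "a > 0" "i \<in> {1..m}" "l \<le> n"
  shows "pmf (map_pmf (\<lambda>x. x i) (dirichlet_multinomial m n a)) l = marginal_mass m n a l"
proof -
  let ?M = "dirichlet_multinomial m n a"
  have p: "pmf ?M x = (if x \<in> count_vectors m n then dirmult_mass m n a x else 0)" for x
    using assms by (intro pmf_dirichlet_multinomial) auto
  have s: "set_pmf ?M \<subseteq> count_vectors m n"
    by (auto simp: set_pmf_eq p split: if_splits)
  have "pmf (map_pmf (\<lambda>x. x i) ?M) l = measure ?M ((\<lambda>x. x i) -` {l})"
    by (simp add: pmf_map)
  \<comment> \<open>Vectors outside \<open>count_vectors m n\<close> have probability zero;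
    discarding them makes the event finite.\<close>
  also have "\<dots> = measure ?M {x. x \<in> count_vectors m n \<and> x i = l}"
    using s by (intro measure_prob_cong_0) (auto simp: set_pmf_eq)
  also have "\<dots> = (\<Sum>x | x \<in> count_vectors m n \<and> x i = l. pmf ?M x)"
    by (intro measure_measure_pmf_finite) (auto simp: finite_count_vectors)
  also have "\<dots> = (\<Sum>x | x \<in> count_vectors m n \<and> x i = l. dirmult_mass m n a x)"
    by (intro sum.cong) (auto simp: p)
  finally show ?thesis using assms by (simp add: sum_dirmult_mass_coordinate)
qed

section \<open>Log-likelihood, score and observed information\<close>

definition dirmult_loglik :: "nat \<Rightarrow> nat \<Rightarrow> (nat \<Rightarrow> nat) \<Rightarrow> real \<Rightarrow> real" where
  "dirmult_loglik m n x t = ln (fact n / (\<Prod>i=1..m. fact (x i)))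
     + (\<Sum>i=1..m. \<Sum>j<x i. ln (t + real j)) - (\<Sum>j<n. ln (real m * t + real j))"

definition dirmult_score :: "nat \<Rightarrow> nat \<Rightarrow> (nat \<Rightarrow> nat) \<Rightarrow> real \<Rightarrow> real" where
  "dirmult_score m n x t =
     (\<Sum>i=1..m. \<Sum>j<x i. 1 / (t + real j)) - (\<Sum>j<n. real m / (real m * t + real j))"

text \<open>The sign is that of minus the second derivative of the log-likelihood, so the mean is
  the Fisher information.\<close>

definition dirmult_obs_info :: "nat \<Rightarrow> nat \<Rightarrow> (nat \<Rightarrow> nat) \<Rightarrow> real \<Rightarrow> real" where
  "dirmult_obs_info m n x t =
     (\<Sum>i=1..m. \<Sum>j<x i. 1 / (t + real j)\<^sup>2) - (\<Sum>j<n. (real m)\<^sup>2 / (real m * t + real j)\<^sup>2)"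

text \<open>Each rising factorial is the exponential of a finite sum of logarithms, so later
  differentiation involves no digamma functions.\<close>

lemma dirmult_mass_eq_exp:
  assumes "m \<ge> 1" "t > 0"
  shows "dirmult_mass m n t x = exp (dirmult_loglik m n x t)"
proof -
  have e: "pochhammer b k = exp (\<Sum>j<k. ln (b + real j))" if "b > 0" for b :: real and k
    using that by (simp add: pochhammer_prod exp_sum atLeast0LessThan add_pos_nonneg)
  have F: "exp (ln (fact n / (\<Prod>i=1..m. fact (x i)))) = (fact n / (\<Prod>i=1..m. fact (x i)) :: real)"
    by (intro exp_ln divide_pos_pos prod_pos) auto
  have "real m * t > 0" using assms by simp
  then show ?thesis
    using assms(2)
    unfolding dirmult_mass_eq_pochhammer[OF assms] dirmult_loglik_def exp_add exp_diff F
    by (simp add: e exp_sum prod_dividef)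
qed

lemma DERIV_dirmult_loglik:
  assumes "m \<ge> 1" "t > 0"
  shows "(dirmult_loglik m n x has_real_derivative dirmult_score m n x t) (at t)"
proof -
  have "real m * t + real j > 0" "t + real j > 0" for j
    using assms by (auto intro: add_pos_nonneg)
  then show ?thesis
    unfolding dirmult_loglik_def[abs_def] dirmult_score_def
    by (auto intro!: derivative_eq_intros sum.cong)
qed

lemma DERIV_dirmult_score:
  assumes "m \<ge> 1" "t > 0"
  shows "(dirmult_score m n x has_real_derivative - dirmult_obs_info m n x t) (at t)"
proof -
  have "real m * t + real j > 0" "t + real j > 0" for j
    using assms by (auto intro: add_pos_nonneg)
  then have nz: "real m * t + real j \<noteq> 0" "t + real j \<noteq> 0" for j
    by (metis less_irrefl)+
  have A: "((\<lambda>t. 1 / (t + real j)) has_real_derivative - (1 / (t + real j)\<^sup>2)) (at t)" for j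
    using nz[of j] by (auto intro!: derivative_eq_intros simp: power2_eq_square)
  have B: "((\<lambda>t. real m / (real m * t + real j)) has_real_derivative
      - ((real m)\<^sup>2 / (real m * t + real j)\<^sup>2)) (at t)" for j
    using nz[of j] by (auto intro!: derivative_eq_intros simp: power2_eq_square)
  show ?thesis
    unfolding dirmult_score_def[abs_def] dirmult_obs_info_def
    by (rule DERIV_cong[OF DERIV_diff[OF DERIV_sum[OF DERIV_sum[OF A]] DERIV_sum[OF B]]])
      (simp add: sum_negf)
qed

lemma DERIV_dirmult_mass:
  assumes "m \<ge> 1" "t > 0"
  shows "((\<lambda>t. dirmult_mass m n t x) has_real_derivative
    dirmult_mass m n t x * dirmult_score m n x t) (at t)"
\<comment> \<open>The exponential form is available only for positive parameters, hence the passage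
  through the open half-line.\<close>
proof (rule has_field_derivative_transform_within_open[of "\<lambda>t. exp (dirmult_loglik m n x t)"])
  show "((\<lambda>t. exp (dirmult_loglik m n x t)) has_real_derivative
      dirmult_mass m n t x * dirmult_score m n x t) (at t)"
    using assms by (auto intro!: derivative_eq_intros DERIV_dirmult_loglik
        simp: dirmult_mass_eq_exp)
  show "open {0::real<..}" "t \<in> {0<..}" using assms by auto
qed (use assms in \<open>auto simp: dirmult_mass_eq_exp\<close>)

section \<open>Moment identities for the score\<close>

lemma DERIV_zero_of_locally_const:
  fixes f :: "real \<Rightarrow> real"
  assumes "(f has_real_derivative D) (at a)" "open S" "a \<in> S" "\<And>t. t \<in> S \<Longrightarrow> f t = c"
  shows "D = 0"
proof -
  have "((\<lambda>_. c) has_real_derivative D) (at a)"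
    by (rule has_field_derivative_transform_within_open[OF assms(1-3)]) (use assms in auto)
  then show ?thesis using DERIV_unique DERIV_const by blast
qed

text \<open>The mean of the score is the derivative of the total mass, which is constantly 1 on the
  half-line.\<close>

lemma sum_dirmult_mass_score:
  assumes "m \<ge> 1" "a > 0"
  shows "(\<Sum>x\<in>count_vectors m n. dirmult_mass m n a x * dirmult_score m n x a) = 0"
proof (rule DERIV_zero_of_locally_const)
  show "((\<lambda>t. \<Sum>x\<in>count_vectors m n. dirmult_mass m n t x) has_real_derivative
      (\<Sum>x\<in>count_vectors m n. dirmult_mass m n a x * dirmult_score m n x a)) (at a)"
    by (intro DERIV_sum DERIV_dirmult_mass assms)
  show "open {0::real<..}" "a \<in> {0<..}" using assms by auto
qed (use assms in \<open>auto intro: sum_dirmult_mass\<close>)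

text \<open>The second Bartlett identity: differentiating the vanishing mean score once more gives
  the difference of the two sides.\<close>

lemma sum_dirmult_mass_obs_info:
  assumes "m \<ge> 1" "a > 0"
  shows "(\<Sum>x\<in>count_vectors m n. dirmult_mass m n a x * dirmult_obs_info m n x a)
       = (\<Sum>x\<in>count_vectors m n. dirmult_mass m n a x * (dirmult_score m n x a)\<^sup>2)"
proof -
  \<comment> \<open>The summand is kept in the form produced by \<open>DERIV_mult\<close>.\<close>
  have "(\<Sum>x\<in>count_vectors m n. dirmult_mass m n a x * dirmult_score m n x a * dirmult_score m n x a
      + - dirmult_obs_info m n x a * dirmult_mass m n a x) = 0"
  proof (rule DERIV_zero_of_locally_const)
    show "((\<lambda>t. \<Sum>x\<in>count_vectors m n. dirmult_mass m n t x * dirmult_score m n x t)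
        has_real_derivative
        (\<Sum>x\<in>count_vectors m n. dirmult_mass m n a x * dirmult_score m n x a * dirmult_score m n x a
          + - dirmult_obs_info m n x a * dirmult_mass m n a x)) (at a)"
      by (intro DERIV_sum DERIV_mult DERIV_dirmult_mass DERIV_dirmult_score assms)
    show "open {0::real<..}" "a \<in> {0<..}" using assms by auto
  qed (use assms in \<open>auto intro: sum_dirmult_mass_score\<close>)
  then show ?thesis
    by (simp add: sum_subtractf power2_eq_square algebra_simps)
qed

section \<open>Evaluation of the Fisher information\<close>

lemma deriv_deriv_ln_pmf:
  assumes "m \<ge> 1" "a > 0" "x \<in> count_vectors m n"
  shows "deriv (deriv (\<lambda>t. ln (pmf (dirichlet_multinomial m n t) x))) a = - dirmult_obs_info m n x a"
proof -
  let ?f = "\<lambda>t. ln (pmf (dirichlet_multinomial m n t) x)"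
  have f: "?f t = dirmult_loglik m n x t" if "t > 0" for t
    using assms that by (simp add: pmf_dirichlet_multinomial dirmult_mass_eq_exp)
  \<comment> \<open>The first derivative is needed on a whole neighbourhood of \<open>a\<close>,
    because the outer \<open>deriv\<close> acts on it as a function.\<close>
  have f': "deriv ?f t = dirmult_score m n x t" if "t > 0" for t
  proof (rule DERIV_imp_deriv, rule has_field_derivative_transform_within_open)
    show "(dirmult_loglik m n x has_real_derivative dirmult_score m n x t) (at t)"
      using assms that by (intro DERIV_dirmult_loglik)
    show "open {0::real<..}" "t \<in> {0<..}" using that by auto
  qed (simp add: f)
  show ?thesis
  proof (rule DERIV_imp_deriv, rule has_field_derivative_transform_within_open)
    show "(dirmult_score m n x has_real_derivative - dirmult_obs_info m n x a) (at a)"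
      using assms by (intro DERIV_dirmult_score)
    show "open {0::real<..}" "a \<in> {0<..}" using assms by auto
  qed (simp add: f')
qed

text \<open>The support lies in the finite set \<open>count_vectors m n\<close>, so the expectation
  is a finite sum and the second derivative matters only there.\<close>

lemma fisher_information_dirmult:
  assumes "m \<ge> 1" "a > 0"
  shows "fisher_information (dirichlet_multinomial m n) a
       = (\<Sum>x\<in>count_vectors m n. dirmult_mass m n a x * dirmult_obs_info m n x a)"
proof -
  let ?M = "dirichlet_multinomial m n a"
  have "set_pmf ?M \<subseteq> count_vectors m n"
    using assms by (auto simp: set_pmf_eq pmf_dirichlet_multinomial split: if_splits)
  then have "fisher_information (dirichlet_multinomial m n) a
      = (\<Sum>x\<in>count_vectors m n. pmf ?M x *
          - deriv (deriv (\<lambda>t. ln (pmf (dirichlet_multinomial m n t) x))) a)"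
    unfolding fisher_information_def
    by (subst integral_measure_pmf[of "count_vectors m n"]) (auto simp: finite_count_vectors)
  also have "\<dots> = (\<Sum>x\<in>count_vectors m n. dirmult_mass m n a x * dirmult_obs_info m n x a)"
    using assms by (intro sum.cong) (auto simp: deriv_deriv_ln_pmf pmf_dirichlet_multinomial)
  finally show ?thesis .
qed

lemma fisher_information_dirmult_nonneg:
  assumes "m \<ge> 1" "a > 0"
  shows "fisher_information (dirichlet_multinomial m n) a \<ge> 0"
  unfolding fisher_information_dirmult[OF assms] sum_dirmult_mass_obs_info[OF assms]
  using dirmult_mass_nonneg[OF assms] by (intro sum_nonneg mult_nonneg_nonneg) auto

text \<open>Tail summation: after exchanging the sums, \<open>h j\<close> collects the mass of all l
  with j < l \<le> n, which is \<open>Q m n a j\<close>.\<close>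

lemma sum_marginal_mass_partial_sums:
  "(\<Sum>l\<le>n. marginal_mass m n a l * (\<Sum>j<l. h j)) = (\<Sum>j<n. Q m n a j * h j)"
proof -
  have "(\<Sum>l\<le>n. marginal_mass m n a l * (\<Sum>j<l. h j))
      = (\<Sum>l\<le>n. \<Sum>j | j \<in> {..<n} \<and> j < l. marginal_mass m n a l * h j)"
    unfolding sum_distrib_left by (intro sum.cong) auto
  also have "\<dots> = (\<Sum>j<n. \<Sum>l | l \<in> {..n} \<and> j < l. marginal_mass m n a l * h j)"
    by (rule sum.swap_restrict) auto
  also have "\<dots> = (\<Sum>j<n. Q m n a j * h j)"
    unfolding Q_def sum_distrib_right by (intro sum.cong) auto
  finally show ?thesis .
qed

lemma fisher_information_dirmult_eq_Q:
  assumes "m \<ge> 2" "a > 0"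
  shows "fisher_information (dirichlet_multinomial m n) a
       = real m * (\<Sum>j<n. Q m n a j / (a + real j)\<^sup>2 - real m / (real m * a + real j)\<^sup>2)"
proof -
  let ?C = "count_vectors m n" and ?p = "dirmult_mass m n a"
  let ?s = "\<lambda>k. \<Sum>j<k. 1 / (a + real j)\<^sup>2"
  let ?K = "\<Sum>j<n. (real m)\<^sup>2 / (real m * a + real j)\<^sup>2"
  have m: "m \<ge> 1" using assms by simp
  have "fisher_information (dirichlet_multinomial m n) a
      = (\<Sum>x\<in>?C. \<Sum>i=1..m. ?p x * ?s (x i)) - (\<Sum>x\<in>?C. ?p x) * ?K"
    unfolding fisher_information_dirmult[OF m assms(2)] dirmult_obs_info_def
    unfolding right_diff_distrib sum_subtractf sum_distrib_right
    by (subst sum_distrib_left) (rule refl)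
  also have "(\<Sum>x\<in>?C. \<Sum>i=1..m. ?p x * ?s (x i)) = (\<Sum>i=1..m. \<Sum>x\<in>?C. ?p x * ?s (x i))"
    by (rule sum.swap)
  \<comment> \<open>All coordinates have the same marginal, so the summand no longer depends on i
    and the outer sum becomes a factor m.\<close>
  also have "\<dots> = (\<Sum>i=1..m. \<Sum>j<n. Q m n a j * (1 / (a + real j)\<^sup>2))"
    using assms by (intro sum.cong refl)
      (simp only: sum_dirmult_mass_times_coordinate[where g = ?s] sum_marginal_mass_partial_sums)
  \<comment> \<open>The total mass is 1; one factor m of the square in \<open>?K\<close> is pulled
    out, the other stays in the numerator.\<close>
  also have "\<dots> - (\<Sum>x\<in>?C. ?p x) * ?K
      = real m * (\<Sum>j<n. Q m n a j / (a + real j)\<^sup>2 - real m / (real m * a + real j)\<^sup>2)"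
    unfolding sum_dirmult_mass[OF m assms(2)]
    by (simp add: sum_subtractf sum_distrib_left right_diff_distrib power2_eq_square)
  finally show ?thesis .
qed

theorem proposition4p1:
  fixes m n :: nat
  assumes "m \<ge> 2" and "n \<ge> 1"
  shows "(\<forall>a>0. \<forall>i\<in>{1..m}. \<forall>l\<in>{0..n}.
            pmf (map_pmf (\<lambda>x. x i) (dirichlet_multinomial m n a)) l = marginal_mass m n a l) \<and>
         (\<forall>a>0. 0 \<le> (\<Sum>j=0..n-1. (Q m n a j / (a + real j)\<^sup>2 - real m / (real m * a + real j)\<^sup>2))) \<and>
         (\<forall>\<pi> :: real \<Rightarrow> real.
            is_jeffreys_prior (dirichlet_multinomial m n) {0<..} \<pi> \<longleftrightarrow>
            (\<exists>c>0. \<forall>a\<in>{0<..}. \<pi> a =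
               c * sqrt (\<Sum>j=0..n-1. (Q m n a j / (a + real j)\<^sup>2 - real m / (real m * a + real j)\<^sup>2))))"
proof -
  let ?S = "\<lambda>a. \<Sum>j=0..n-1. (Q m n a j / (a + real j)\<^sup>2 - real m / (real m * a + real j)\<^sup>2)"
  let ?I = "fisher_information (dirichlet_multinomial m n)"
  have m: "m \<ge> 1" "real m > 0" using assms by auto
  \<comment> \<open>This uses n \<ge> 1: for n = 0 truncated subtraction would leave the index 0 on
    the left.\<close>
  have "{0..n-1} = {..<n}" using assms by auto
  then have I: "?I a = real m * ?S a" if "a > 0" for a
    using fisher_information_dirmult_eq_Q[OF assms(1) that, of n] by simp
  have nonneg: "0 \<le> ?S a" if "a > 0" for a
    using fisher_information_dirmult_nonneg[OF m(1) that, of n] m(2)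
    unfolding I[OF that] by (simp add: zero_le_mult_iff)
  \<comment> \<open>The factor \<open>sqrt (real m)\<close> is free of \<open>a\<close>, so it is
    absorbed into the constant: multiplied in for one direction below, divided out for the
    other.\<close>
  have sqrtI: "sqrt (?I a) = sqrt (real m) * sqrt (?S a)" if "a > 0" for a
    unfolding I[OF that] by (rule real_sqrt_mult)
  have "is_jeffreys_prior (dirichlet_multinomial m n) {0<..} \<pi> \<longleftrightarrow>
      (\<exists>c>0. \<forall>a\<in>{0<..}. \<pi> a = c * sqrt (?S a))" for \<pi>
  proof
    assume "is_jeffreys_prior (dirichlet_multinomial m n) {0<..} \<pi>"
    then obtain c where c: "c > 0" "\<And>a. a > 0 \<Longrightarrow> \<pi> a = c * sqrt (?I a)"
      by (auto simp: is_jeffreys_prior_def)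
    show "\<exists>c>0. \<forall>a\<in>{0<..}. \<pi> a = c * sqrt (?S a)"
      using c(1) m by (intro exI[of _ "c * sqrt (real m)"]) (auto simp: c(2) sqrtI)
  next
    assume "\<exists>c>0. \<forall>a\<in>{0<..}. \<pi> a = c * sqrt (?S a)"
    then obtain c where c: "c > 0" "\<And>a. a > 0 \<Longrightarrow> \<pi> a = c * sqrt (?S a)"
      by auto
    show "is_jeffreys_prior (dirichlet_multinomial m n) {0<..} \<pi>"
      unfolding is_jeffreys_prior_def
      using c(1) m by (intro exI[of _ "c / sqrt (real m)"]) (auto simp: c(2) sqrtI)
  qed
  then show ?thesis
    using nonneg assms(1) by (auto intro: pmf_map_coordinate)
qed

end
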